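(* Let $s \ge 5$ be odd and let $X$ be an antipodal $s$-distance set in the unit sphere $S^{d-1}\subset\mathbb{R}^d$ with $B(X) = \{-1, \pm\beta_1, \pm\beta_2, \ldots, \pm\beta_{(s-1)/2}\}$ (a set of exactly $s$ elements). (1) Let $N = \binom{d+s-4}{s-3}$. If $|X| \ge 4N$, then for each $i = 1, \ldots, (s-1)/2$ the number \[ k_i = \prod_{j=1,\ldots,(s-1)/2,\ j \neq i} \frac{1 - \beta_j^2}{\beta_i^2 - \beta_j^2} \] is an integer, and $|k_i| \le U(N)$. (2) Let $N = \binom{d+s-3}{s-2}$. If $|X| \ge 4N + 2$, then for each $i = 1, \ldots, (s-1)/2$ the number \[ k_i = \frac{1}{\beta_i} \prod_{j=1,\ldots,(s-1)/2,\ j \neq i} \frac{1 - \beta_j^2}{\beta_i^2 - \beta_j^2} \] is an integer, and $|k_i| \le \left\lfloor \sqrt{2N^2/(N+1)} \right\rfloor$.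
   Context: A finite set $X \subset \mathbb{R}^d$ is an $s$-distance set if the set of Euclidean distances between distinct points of $X$ has exactly $s$ elements. $X$ is antipodal if $-x \in X$ for every $x \in X$. For $X \subset S^{d-1}$, $B(X) = \{(x,y) : x, y \in X, x \neq y\}$, where $(\cdot,\cdot)$ is the standard inner product. The function $U$ is defined by $U(N) = \left\lfloor \frac{1}{2} + \sqrt{\frac{N^2}{2N-2} + \frac{1}{4}} \right\rfloor$. *)

theory Defs
  imports "HOL-Analysis.Analysis"
begin

definition s_distance_set :: "('a::metric_space) set \<Rightarrow> nat \<Rightarrow> bool" where
  "s_distance_set X s \<longleftrightarrow> finite X \<and>
     card {dist x y | x y. x \<in> X \<and> y \<in> X \<and> x \<noteq> y} = s"

definition antipodal :: "('a::real_vector) set \<Rightarrow> bool" where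
  "antipodal X \<longleftrightarrow> (\<forall>x\<in>X. - x \<in> X)"

definition on_unit_sphere :: "('a::real_normed_vector) set \<Rightarrow> bool" where
  "on_unit_sphere X \<longleftrightarrow> X \<subseteq> sphere 0 1"

definition inner_set :: "('a::real_inner) set \<Rightarrow> real set" where
  "inner_set X = {inner x y | x y. x \<in> X \<and> y \<in> X \<and> x \<noteq> y}"

definition U :: "nat \<Rightarrow> int" where
  "U N = \<lfloor>1/2 + sqrt ((real N)^2 / (2 * real N - 2) + 1/4)\<rfloor>"

end

theory Submission
  imports Defs "Jordan_Normal_Form.Char_Poly"
begin

text \<open>
  Let \<open>Y\<close> be a subset of half of \<open>X\<close> that contains no antipodal pair. The values on \<open>Y\<close> of the
  polynomial in the inner product that vanishes at every \<open>\<plusminus>\<beta> j\<close> with \<open>j \<noteq> i\<close> form a matrix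
  \<open>k I + A\<close>, where \<open>A\<close> has entries in \<open>{-1, 0, 1}\<close>. Homogenizing the polynomial shows that this matrix
  factors through the \<open>N\<close>-dimensional space of forms of the corresponding degree, so \<open>- k\<close> is an
  eigenvalue of the integer matrix \<open>A\<close> of multiplicity at least \<open>card Y - N\<close>. The minimal polynomial
  of \<open>- k\<close> over the rationals occurs to that power in the characteristic polynomial of \<open>A\<close>, which for
  \<open>card Y \<ge> 2 * N + 1\<close> forces it to be linear. The bounds on \<open>k\<close> come from
  \<open>(tr M)\<^sup>2 \<le> rank M * \<parallel>M\<parallel>\<^sup>2\<close> (Frobenius norm), where in the even case \<open>M\<close> is \<open>k I + A\<close> minus \<open>1/2\<close> times the
  all-ones matrix, so that all off-diagonal entries become \<open>\<plusminus>1/2\<close>.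
\<close>

subsection \<open>Characteristic polynomials\<close>

text \<open>A form of Sylvester's determinant identity. The block matrix \<open>?E\<close> becomes
  block upper triangular both as \<open>?L * ?E\<close> and as \<open>?E * ?R\<close>, so
  \<open>det ?E\<close> is evaluated twice, with \<open>det ?L = 1\<close> and
  \<open>det ?R = y ^ m\<close>. Any integral domain is allowed so that \<open>y\<close> can be a
  polynomial.\<close>

lemma det_smult_one_minus_mult_swap:
  fixes B C :: "'a :: idom mat"
  assumes B: "B \<in> carrier_mat n m" and C: "C \<in> carrier_mat m n"
  shows "y ^ m * Determinant.det (y \<cdot>\<^sub>m 1\<^sub>m n - B * C) = y ^ n * Determinant.det (y \<cdot>\<^sub>m 1\<^sub>m m - C * B)"
proof -
  let ?E = "four_block_mat (1\<^sub>m m) C B (y \<cdot>\<^sub>m 1\<^sub>m n)"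
  let ?L = "four_block_mat (1\<^sub>m m) (0\<^sub>m m n) (- B) (1\<^sub>m n)"
  let ?R = "four_block_mat (y \<cdot>\<^sub>m 1\<^sub>m m) (0\<^sub>m m n) (- B) (1\<^sub>m n)"
  have E: "?E \<in> carrier_mat (m + n) (m + n)" and L: "?L \<in> carrier_mat (m + n) (m + n)"
    and R: "?R \<in> carrier_mat (m + n) (m + n)" using B C by auto
  have LE: "?L * ?E = four_block_mat (1\<^sub>m m) C (0\<^sub>m n m) (y \<cdot>\<^sub>m 1\<^sub>m n - B * C)"
    using B C by (subst mult_four_block_mat[of _ m m _ n _ n _ _ m _ n])
      (auto intro!: cong_four_block_mat simp: uminus_l_inv_mat)
  have ER: "?E * ?R = four_block_mat (y \<cdot>\<^sub>m 1\<^sub>m m - C * B) C (0\<^sub>m n m) (y \<cdot>\<^sub>m 1\<^sub>m n)"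
    using B C by (subst mult_four_block_mat[of _ m m _ n _ n _ _ m _ n])
      (auto intro!: cong_four_block_mat simp: mult_smult_distrib mult_smult_assoc_mat)
  have "Determinant.det ?L = 1" using B
    by (subst det_four_block_mat_upper_right_zero[where n=m and m=n]) auto
  moreover have "Determinant.det ?R = y ^ m" using B
    by (subst det_four_block_mat_upper_right_zero[where n=m and m=n]) auto
  moreover have "Determinant.det (?L * ?E) = Determinant.det (y \<cdot>\<^sub>m 1\<^sub>m n - B * C)"
    unfolding LE using B C by (subst det_four_block_mat_lower_left_zero[where n=m and m=n]) auto
  moreover have "Determinant.det (?E * ?R) = Determinant.det (y \<cdot>\<^sub>m 1\<^sub>m m - C * B) * y ^ n"
    unfolding ER using B C by (subst det_four_block_mat_lower_left_zero[where n=m and m=n]) auto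
  ultimately show ?thesis using det_mult[OF L E] det_mult[OF E R] by (simp add: mult.commute)
qed

text \<open>The characteristic matrix is \<open>y I - B C\<close> for \<open>y = X - a\<close>. The
  swap identity over the polynomial ring trades it for an \<open>m\<close> by \<open>m\<close>
  determinant times \<open>y ^ n\<close>, and cancelling \<open>y ^ m\<close> leaves the claimed
  power.\<close>

lemma char_poly_low_rank_plus_scalar:
  fixes B C :: "'a :: idom mat"
  assumes B: "B \<in> carrier_mat n m" and C: "C \<in> carrier_mat m n" and "m \<le> n"
  shows "[:- a, 1:] ^ (n - m) dvd char_poly (B * C + a \<cdot>\<^sub>m 1\<^sub>m n)"
proof -
  let ?c = "map_mat (\<lambda>x. [:x:])"
  let ?y = "[:- a, 1:]"
  have cB: "?c B \<in> carrier_mat n m" and cC: "?c C \<in> carrier_mat m n" using B C by auto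
  interpret c: comm_ring_hom "\<lambda>x::'a. [:x:]" by unfold_locales auto
  have BC: "?c (B * C) = ?c B * ?c C" using c.mat_hom_mult[OF B C] .
  have "char_poly_matrix (B * C + a \<cdot>\<^sub>m 1\<^sub>m n) = ?y \<cdot>\<^sub>m 1\<^sub>m n - ?c B * ?c C"
    unfolding BC[symmetric] char_poly_matrix_def using B C by (intro eq_matI) auto
  then have "?y ^ m * char_poly (B * C + a \<cdot>\<^sub>m 1\<^sub>m n)
      = ?y ^ n * Determinant.det (?y \<cdot>\<^sub>m 1\<^sub>m m - ?c C * ?c B)"
    unfolding char_poly_def using det_smult_one_minus_mult_swap[OF cB cC, of ?y] by simp
  moreover have "?y ^ n = ?y ^ m * ?y ^ (n - m)" using \<open>m \<le> n\<close> by (simp flip: power_add)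
  ultimately have "char_poly (B * C + a \<cdot>\<^sub>m 1\<^sub>m n)
      = ?y ^ (n - m) * Determinant.det (?y \<cdot>\<^sub>m 1\<^sub>m m - ?c C * ?c B)"
    by (simp add: mult.assoc del: mult_pCons_left)
  then show ?thesis by (metis dvd_triv_left)
qed

text \<open>Induction through the derivative, which is the sum of the characteristic polynomials of
  the principal submatrices \<open>mat_delete A i i\<close>. Each diagonal entry is missing from
  exactly one of them, so their traces add up to \<open>Suc n\<close> times the trace of
  \<open>A\<close>; characteristic zero allows division by \<open>Suc n\<close>.\<close>

lemma coeff_char_poly_trace:
  fixes A :: "'a :: {idom, ring_char_0} mat"
  assumes "A \<in> carrier_mat (Suc n) (Suc n)"
  shows "coeff (char_poly A) n = - (\<Sum>i<Suc n. A $$ (i, i))"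
  using assms
proof (induction n arbitrary: A)
  case 0
  then show ?case by (simp add: char_poly_defs det_single)
next
  case (Suc n)
  have D: "mat_delete A i i \<in> carrier_mat (Suc n) (Suc n)" for i
    using mat_delete_carrier[OF Suc.prems, of i i] by simp
  have d: "(\<Sum>j<Suc n. mat_delete A i i $$ (j, j)) = (\<Sum>j<Suc (Suc n). A $$ (j, j)) - A $$ (i, i)"
    if i: "i < Suc (Suc n)" for i
  proof -
    have "(\<Sum>j<Suc n. mat_delete A i i $$ (j, j))
        = (\<Sum>j<Suc n. A $$ (insert_index i j, insert_index i j))"
      using Suc.prems by (intro sum.cong) (auto simp: mat_delete_def insert_index_def)
    also have "\<dots> = sum (\<lambda>j. A $$ (j, j)) (insert_index i ` {..<Suc n})"
      by (subst sum.reindex) (auto intro!: inj_onI simp: insert_index_def split: if_splits)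
    also have "insert_index i ` {..<Suc n} = {..<Suc (Suc n)} - {i}"
      using insert_index_image[of i "Suc n"] i by (simp add: lessThan_atLeast0)
    finally show ?thesis using i by (simp add: sum_diff1 del: sum.lessThan_Suc)
  qed
  have "of_nat (Suc n) * coeff (char_poly A) (Suc n) = coeff (pderiv (char_poly A)) n"
    by (simp add: coeff_pderiv)
  also have "\<dots> = (\<Sum>i<Suc (Suc n). coeff (char_poly (mat_delete A i i)) n)"
    unfolding pderiv_char_poly[OF Suc.prems] coeff_sum ..
  also have "\<dots> = (\<Sum>i<Suc (Suc n). A $$ (i, i) - (\<Sum>j<Suc (Suc n). A $$ (j, j)))"
    by (intro sum.cong refl) (simp only: Suc.IH[OF D] d lessThan_iff, simp)
  also have "\<dots> = of_nat (Suc n) * - (\<Sum>j<Suc (Suc n). A $$ (j, j))"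
    by (simp add: sum_subtractf algebra_simps del: sum.lessThan_Suc)
  finally show ?case by (metis mult_left_cancel of_nat_neq_0)
qed

subsection \<open>Eigenvalues of integer matrices\<close>

text \<open>The minimal polynomial of \<open>x\<close> is an annihilator of least degree, made
  monic; division with remainder shows that it divides every other annihilator. Its derivative is
  nonzero of smaller degree, hence does not vanish at \<open>x\<close>, so the root is
  simple.\<close>

lemma rat_minimal_poly_exists:
  fixes x :: real and q :: "rat poly"
  assumes q: "q \<noteq> 0" "poly (map_poly of_rat q) x = 0"
  obtains p :: "rat poly" where "lead_coeff p = 1" "poly (map_poly of_rat p) x = 0"
    "\<And>r. poly (map_poly of_rat r) x = 0 \<Longrightarrow> p dvd r" "order x (map_poly of_rat p) = 1"
proof -
  interpret hp: map_poly_inj_idom_hom "of_rat :: rat \<Rightarrow> real" ..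
  define Q where "Q = (\<lambda>r :: rat poly. r \<noteq> 0 \<and> poly (map_poly of_rat r) x = 0)"
  define p0 where "p0 = arg_min degree Q"
  have "Q q" using q by (simp add: Q_def)
  then have p0: "Q p0" and min: "\<And>r. Q r \<Longrightarrow> degree p0 \<le> degree r"
    unfolding p0_def using arg_min_natI[of Q q degree] arg_min_nat_le[of Q _ degree] by auto
  define p where "p = Polynomial.smult (inverse (lead_coeff p0)) p0"
  have p: "p \<noteq> 0" "poly (map_poly of_rat p) x = 0" "lead_coeff p = 1" "degree p = degree p0"
    using p0 unfolding p_def Q_def by (auto simp: map_poly_smult of_rat_mult)
  have zero: "r = 0" if "poly (map_poly of_rat r) x = 0" "degree r < degree p" for r
    using that min[of r] p(4) unfolding Q_def by force
  have dv: "p dvd r" if r: "poly (map_poly of_rat r) x = 0" for r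
  proof (cases "degree p = 0")
    case True
    then show ?thesis using p(1) by (metis is_unit_iff_degree unit_imp_dvd)
  next
    case False
    have "r = p * (r div p) + r mod p" by simp
    then have "map_poly of_rat r = map_poly of_rat p * map_poly of_rat (r div p) + (map_poly of_rat (r mod p) :: real poly)"
      by (metis hp.hom_add hp.hom_mult)
    then have "poly (map_poly of_rat (r mod p)) x = 0" using r p(2) by simp
    moreover have "degree (r mod p) < degree p" using False p(1) degree_mod_less[of p r] by auto
    ultimately have "r mod p = 0" by (rule zero)
    then show ?thesis by auto
  qed
  have deg: "degree p \<noteq> 0"
  proof
    assume "degree p = 0"
    then obtain c where "p = [:c:]" by (metis degree_eq_zeroE)
    then show False using p by simp
  qed
  have "pderiv p \<noteq> 0" using deg by (simp add: pderiv_eq_0_iff)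
  then have "poly (map_poly of_rat (pderiv p)) x \<noteq> 0"
    using zero[of "pderiv p"] deg by (auto simp: degree_pderiv)
  then have "poly (pderiv (map_poly of_rat p)) x \<noteq> 0" by (simp add: of_rat_hom.map_poly_pderiv)
  moreover have "map_poly of_rat p \<noteq> (0 :: real poly)" using p(1) by simp
  ultimately have "order x (map_poly of_rat p) = 1"
    using p(2) order_pderiv[of "map_poly of_rat p" x] order_root[of "map_poly of_rat p" x] order_root[of "pderiv (map_poly of_rat p)" x]
    by fastforce
  then show ?thesis using that p dv by blast
qed

text \<open>Multiplicity of a real root turns into a power of a rational factor: since
  \<open>x\<close> is a simple root of \<open>p\<close>, splitting off one factor \<open>p\<close>
  lowers the order of \<open>x\<close> by exactly one.\<close>

lemma minimal_poly_power_dvd: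
  fixes x :: real and p q :: "rat poly"
  assumes "\<And>r. poly (map_poly of_rat r) x = 0 \<Longrightarrow> p dvd r" "order x (map_poly of_rat p) = 1"
    and "q \<noteq> 0" "[:- x, 1:] ^ m dvd map_poly of_rat q"
  shows "p ^ m dvd q"
  using assms(3,4)
proof (induction m arbitrary: q)
  case 0
  then show ?case by simp
next
  case (Suc m)
  interpret hp: map_poly_inj_idom_hom "of_rat :: rat \<Rightarrow> real" ..
  have nz: "map_poly of_rat q \<noteq> (0 :: real poly)" using Suc.prems by simp
  have ord: "Suc m \<le> order x (map_poly of_rat q)"
    using Suc.prems(2) nz by (simp only: order_divides) simp
  then have "poly (map_poly of_rat q) x = 0" using order_root by force
  then obtain r where r: "q = p * r" using assms(1) by blast
  have "order x (map_poly of_rat q) = order x (map_poly of_rat p) + order x (map_poly of_rat r)"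
    using nz unfolding r hp.hom_mult by (rule order_mult)
  then have "m \<le> order x (map_poly of_rat r)" using ord assms(2) by simp
  then have "[:- x, 1:] ^ m dvd map_poly of_rat r" by (simp add: order_divides)
  moreover have "r \<noteq> 0" using r Suc.prems by auto
  ultimately have "p ^ m dvd r" using Suc.IH by blast
  then show ?case unfolding r by simp
qed

text \<open>\<open>A0\<close> witnesses that \<open>x\<close> is an algebraic integer, so a rational
  \<open>x\<close> would be an integer; hence the minimal polynomial is not linear. The conclusion
  quantifies over all \<open>A\<close> so that one \<open>p\<close> can be shared by several
  matrices.\<close>

lemma non_integer_eigenvalue:
  fixes x :: real
  assumes "x \<notin> \<int>" "A0 \<in> carrier_mat n0 n0" "poly (map_poly of_int (char_poly A0)) x = 0"
  obtains p :: "rat poly" where "lead_coeff p = 1" "degree p \<ge> 2"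
    "\<And>A n m. A \<in> carrier_mat n n \<Longrightarrow> [:- x, 1:] ^ m dvd map_poly of_int (char_poly A)
       \<Longrightarrow> p ^ m dvd map_poly of_int (char_poly A)"
proof -
  interpret hp: map_poly_inj_idom_hom "of_rat :: rat \<Rightarrow> real" ..
  have ri: "map_poly of_rat (map_poly of_int P) = (map_poly of_int P :: real poly)" for P
    by (simp add: map_poly_map_poly o_def)
  have nz: "map_poly of_int (char_poly A) \<noteq> (0 :: rat poly)" if "A \<in> carrier_mat n n" for A :: "int mat" and n
    using degree_monic_char_poly[OF that] by (metis coeff_0 coeff_map_poly of_int_0 of_int_1 zero_neq_one)
  have alg: "algebraic_int x"
    unfolding algebraic_int_altdef_ipoly using degree_monic_char_poly[OF assms(2)] assms(3) by blast
  obtain p :: "rat poly" where p: "lead_coeff p = 1" "poly (map_poly of_rat p) x = 0"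
    "\<And>r. poly (map_poly of_rat r) x = 0 \<Longrightarrow> p dvd r" "order x (map_poly of_rat p) = 1"
    using rat_minimal_poly_exists[of "map_poly of_int (char_poly A0)" x] nz[OF assms(2)] assms(3) ri
    by metis
  have "degree p \<noteq> 0"
  proof
    assume "degree p = 0"
    then obtain c where "p = [:c:]" by (metis degree_eq_zeroE)
    then show False using p by simp
  qed
  moreover have "degree p \<noteq> 1"
  proof
    assume "degree p = 1"
    then obtain a b where ab: "p = [:b, a:]" by (metis degree1_coeffs)
    then have "a = 1" using p(1) \<open>degree p = 1\<close> by (simp split: if_splits)
    then have "x = - of_rat b" using p(2) ab by simp
    then have "x \<in> \<rat>" by simp
    then show False using rational_algebraic_int_is_int[OF alg] assms(1) by blast
  qed
  ultimately have "degree p \<ge> 2" by linarith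
  then show ?thesis
    using that p(1) minimal_poly_power_dvd[OF p(3,4)] nz ri by metis
qed

text \<open>Otherwise \<open>p ^ m\<close>, of degree at least \<open>2 * m\<close>, would divide a
  nonzero polynomial of degree \<open>n < 2 * m\<close>.\<close>

lemma integer_eigenvalue_of_large_multiplicity:
  fixes x :: real
  assumes A: "A \<in> carrier_mat n n" and m: "n < 2 * m"
    and d: "[:- x, 1:] ^ m dvd map_poly of_int (char_poly A)"
  shows "x \<in> \<int>"
proof (rule ccontr)
  assume x: "x \<notin> \<int>"
  have "poly (map_poly of_int (char_poly A)) x = 0"
    using dvd_trans[OF dvd_power[of m "[:- x, 1:]"] d] m by (simp add: poly_eq_0_iff_dvd)
  then obtain p :: "rat poly" where p: "lead_coeff p = 1" "degree p \<ge> 2" "p ^ m dvd map_poly of_int (char_poly A)"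
    using non_integer_eigenvalue[OF x A] A d by metis
  have c: "degree (map_poly of_int (char_poly A) :: rat poly) = n" "map_poly of_int (char_poly A) \<noteq> (0 :: rat poly)"
    using degree_monic_char_poly[OF A] by (simp, metis coeff_0 coeff_map_poly of_int_0 of_int_1 zero_neq_one)
  have "degree (p ^ m) \<le> n" using dvd_imp_degree_le[OF p(3) c(2)] c(1) by simp
  moreover have "degree (p ^ m) = m * degree p" using p(1) degree_power_eq[of p m] by (cases "p = 0") (auto simp: mult.commute)
  moreover have "m * 2 \<le> m * degree p" using p(2) by (rule mult_le_mono2)
  ultimately show False using m by linarith
qed

lemma monic_dvd_same_degree:
  fixes f g :: "'a :: field poly"
  assumes "f dvd g" "degree g \<le> degree f" "lead_coeff f = 1" "lead_coeff g = 1"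
  shows "f = g"
proof -
  obtain h where h: "g = f * h" using assms(1) by blast
  have "f \<noteq> 0" "h \<noteq> 0" using h assms by auto
  then have "degree h = 0" using h assms(2) by (simp add: degree_mult_eq)
  then obtain c where "h = [:c:]" by (metis degree_eq_zeroE)
  then show ?thesis using h assms(3,4) by (simp split: if_splits)
qed

text \<open>In the borderline case the degrees leave no room: \<open>p ^ m\<close> has degree at
  least \<open>2 * m\<close> and divides two monic polynomials of degree \<open>2 * m\<close>, so
  both equal \<open>p ^ m\<close>.\<close>

lemma char_poly_eq_of_non_integer_half_multiplicity:
  fixes x :: real
  assumes A: "A \<in> carrier_mat (2 * m) (2 * m)" and A': "A' \<in> carrier_mat (2 * m) (2 * m)" and m: "m > 0"
    and d: "[:- x, 1:] ^ m dvd map_poly of_int (char_poly A)"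
    and d': "[:- x, 1:] ^ m dvd map_poly of_int (char_poly A')"
    and x: "x \<notin> \<int>"
  shows "char_poly A = char_poly A'"
proof -
  have "poly (map_poly of_int (char_poly A)) x = 0"
    using dvd_trans[OF dvd_power[of m "[:- x, 1:]"] d] m by (simp add: poly_eq_0_iff_dvd)
  then obtain p :: "rat poly" where p: "lead_coeff p = 1" "degree p \<ge> 2"
    "p ^ m dvd map_poly of_int (char_poly A)" "p ^ m dvd map_poly of_int (char_poly A')"
    using non_integer_eigenvalue[OF x A] A A' d d' by metis
  have pm: "lead_coeff (p ^ m) = 1" "degree (p ^ m) = m * degree p"
  proof -
    have "p \<noteq> 0" using p(1) by auto
    then show "degree (p ^ m) = m * degree p" by (simp add: degree_power_eq mult.commute)
  qed (use p(1) in \<open>rule monic_power\<close>)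
  have eq: "p ^ m = map_poly of_int (char_poly C)"
    if C: "C \<in> carrier_mat (2 * m) (2 * m)" and dv: "p ^ m dvd map_poly of_int (char_poly C)" for C :: "int mat"
  proof (rule monic_dvd_same_degree[OF dv _ pm(1)])
    show "degree (map_poly of_int (char_poly C) :: rat poly) \<le> degree (p ^ m)"
      using degree_monic_char_poly[OF C] pm p(2) m by (simp add: degree_map_poly)
    show "lead_coeff (map_poly of_int (char_poly C) :: rat poly) = 1"
      using degree_monic_char_poly[OF C] by (simp add: degree_map_poly coeff_map_poly)
  qed
  have "map_poly of_int (char_poly A) = (map_poly of_int (char_poly A') :: rat poly)"
    using eq[OF A p(3)] eq[OF A' p(4)] by simp
  then show ?thesis by (simp add: poly_eq_iff coeff_map_poly)
qed

subsection \<open>Trace and rank\<close>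

text \<open>\<open>P\<close> is the matrix of the orthogonal projection onto the span of the vectors
  \<open>b l\<close>, built by Gram-Schmidt. Its trace is the dimension of that span, which may be
  below \<open>card L\<close> because the vectors can be dependent.\<close>

lemma projection_onto_finite_span:
  fixes b :: "'l \<Rightarrow> 'a \<Rightarrow> real"
  assumes Y: "finite Y" and L: "finite L"
  shows "\<exists>P. (\<forall>x\<in>Y. \<forall>y\<in>Y. P x y = P y x) \<and> (\<forall>x\<in>Y. \<forall>z\<in>Y. (\<Sum>y\<in>Y. P x y * P y z) = P x z)
     \<and> (\<forall>l\<in>L. \<forall>x\<in>Y. (\<Sum>y\<in>Y. P x y * b l y) = b l x) \<and> (\<Sum>x\<in>Y. P x x) \<le> real (card L)"
  using L
proof (induction L rule: finite_induct)
  case empty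
  show ?case by (rule exI[of _ "\<lambda>_ _. 0"]) simp
next
  case (insert l L)
  then obtain P where sym: "\<And>x y. x \<in> Y \<Longrightarrow> y \<in> Y \<Longrightarrow> P x y = P y x"
    and idem: "\<And>x z. x \<in> Y \<Longrightarrow> z \<in> Y \<Longrightarrow> (\<Sum>y\<in>Y. P x y * P y z) = P x z"
    and fixd: "\<And>l x. l \<in> L \<Longrightarrow> x \<in> Y \<Longrightarrow> (\<Sum>y\<in>Y. P x y * b l y) = b l x"
    and tr: "(\<Sum>x\<in>Y. P x x) \<le> real (card L)" by blast
  \<comment> \<open>\<open>h\<close> is the residual of the new vector, orthogonal to the old span,
    and \<open>H\<close> is its squared length. If \<open>H = 0\<close>, the vector already lies in
    the span and \<open>P\<close> is kept.\<close>
  define h where "h x = b l x - (\<Sum>y\<in>Y. P x y * b l y)" for x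
  define H where "H = (\<Sum>x\<in>Y. h x * h x)"
  have Ph: "(\<Sum>y\<in>Y. P x y * h y) = 0" if x: "x \<in> Y" for x
  proof -
    have "(\<Sum>y\<in>Y. P x y * (\<Sum>z\<in>Y. P y z * b l z)) = (\<Sum>z\<in>Y. (\<Sum>y\<in>Y. P x y * P y z) * b l z)"
      by (simp add: sum_distrib_left sum_distrib_right mult.assoc) (rule sum.swap)
    also have "\<dots> = (\<Sum>z\<in>Y. P x z * b l z)" using idem[OF x] by simp
    finally show ?thesis unfolding h_def by (simp add: right_diff_distrib sum_subtractf)
  qed
  show ?case
  proof (cases "H = 0")
    case True
    then have "h x = 0" if "x \<in> Y" for x
      using that Y unfolding H_def by (simp add: sum_nonneg_eq_0_iff)
    then show ?thesis using sym idem fixd tr insert.hyps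
      by (intro exI[of _ P]) (auto simp: h_def)
  next
    case False
    \<comment> \<open>Adds the rank-one projection onto \<open>h\<close>, whose trace is 1.\<close>
    define Q where "Q x y = P x y + h x * h y / H" for x y
    have hP: "(\<Sum>y\<in>Y. h y * P y x) = 0" if x: "x \<in> Y" for x
    proof -
      have "(\<Sum>y\<in>Y. h y * P y x) = (\<Sum>y\<in>Y. P x y * h y)" by (intro sum.cong) (auto simp: sym x)
      then show ?thesis using Ph[OF x] by simp
    qed
    have hb: "(\<Sum>y\<in>Y. h y * b l' y) = 0" if l': "l' \<in> L" for l'
    proof -
      have "(\<Sum>y\<in>Y. h y * b l' y) = (\<Sum>y\<in>Y. h y * (\<Sum>z\<in>Y. P y z * b l' z))"
        by (intro sum.cong refl) (simp add: fixd[OF l'])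
      also have "\<dots> = (\<Sum>z\<in>Y. (\<Sum>y\<in>Y. h y * P y z) * b l' z)"
        by (simp add: sum_distrib_left sum_distrib_right mult.assoc) (rule sum.swap)
      finally show ?thesis using hP by simp
    qed
    \<comment> \<open>The part of \<open>b l\<close> inside the old span is orthogonal to
      \<open>h\<close>, so pairing \<open>h\<close> with \<open>b l\<close> gives \<open>H\<close>.
      This is the scaling that makes \<open>Q\<close> fix \<open>b l\<close>.\<close>
    have hl: "(\<Sum>y\<in>Y. h y * b l y) = H"
    proof -
      have "(\<Sum>y\<in>Y. h y * (\<Sum>z\<in>Y. P y z * b l z)) = (\<Sum>z\<in>Y. (\<Sum>y\<in>Y. h y * P y z) * b l z)"
        by (simp add: sum_distrib_left sum_distrib_right mult.assoc) (rule sum.swap)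
      also have "\<dots> = 0" using hP by simp
      finally have "(\<Sum>y\<in>Y. h y * (\<Sum>z\<in>Y. P y z * b l z)) = 0" .
      moreover have "H = (\<Sum>y\<in>Y. h y * b l y) - (\<Sum>y\<in>Y. h y * (\<Sum>z\<in>Y. P y z * b l z))"
        unfolding H_def sum_subtractf[symmetric] by (intro sum.cong refl) (simp add: h_def algebra_simps)
      ultimately show ?thesis by simp
    qed
    have Qf: "(\<Sum>y\<in>Y. Q x y * f y) = (\<Sum>y\<in>Y. P x y * f y) + h x * (\<Sum>y\<in>Y. h y * f y) / H" for f x
      unfolding Q_def by (simp add: distrib_right sum.distrib sum_distrib_left sum_divide_distrib mult.assoc)
    have 1: "Q x y = Q y x" if "x \<in> Y" "y \<in> Y" for x y
      using sym that by (simp add: Q_def mult.commute)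
    have 2: "(\<Sum>y\<in>Y. Q x y * Q y z) = Q x z" if x: "x \<in> Y" and z: "z \<in> Y" for x z
    proof -
      have "(\<Sum>y\<in>Y. f y * Q y z) = (\<Sum>y\<in>Y. f y * P y z) + (\<Sum>y\<in>Y. f y * h y) * h z / H" for f
        unfolding Q_def by (simp add: distrib_left sum.distrib sum_distrib_right sum_divide_distrib mult.assoc)
      then show ?thesis unfolding Qf using idem[OF x z] hP[OF z] Ph[OF x] False
        by (simp add: H_def[symmetric] Q_def)
    qed
    have 3: "(\<Sum>y\<in>Y. Q x y * b l' y) = b l' x" if "l' \<in> insert l L" "x \<in> Y" for l' x
      using that fixd hb hl False unfolding Qf by (auto simp: h_def)
    have 4: "(\<Sum>x\<in>Y. Q x x) \<le> real (card (insert l L))"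
      using tr insert.hyps False
      by (simp add: Q_def sum.distrib sum_divide_distrib[symmetric] H_def[symmetric])
    show ?thesis using 1 2 3 4 by blast
  qed
qed

text \<open>The columns of \<open>M\<close> lie in the span of the \<open>b l\<close>, so the
  projection gives \<open>P M = M\<close> and \<open>tr M = tr (P M)\<close>. Cauchy-Schwarz for the
  Frobenius inner product then applies, where the squared norm of \<open>P\<close> is
  \<open>tr P\<close>, at most \<open>card L\<close>.\<close>

lemma trace_squared_le_rank_times_frobenius:
  fixes M :: "'a \<Rightarrow> 'a \<Rightarrow> real"
  assumes Y: "finite Y" and L: "finite L"
    and M: "\<And>x y. x \<in> Y \<Longrightarrow> y \<in> Y \<Longrightarrow> M x y = (\<Sum>l\<in>L. b l x * c l y)"
  shows "(\<Sum>x\<in>Y. M x x)\<^sup>2 \<le> real (card L) * (\<Sum>x\<in>Y. \<Sum>y\<in>Y. (M x y)\<^sup>2)"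
proof -
  obtain P where sym: "\<And>x y. x \<in> Y \<Longrightarrow> y \<in> Y \<Longrightarrow> P x y = P y x"
    and idem: "\<And>x z. x \<in> Y \<Longrightarrow> z \<in> Y \<Longrightarrow> (\<Sum>y\<in>Y. P x y * P y z) = P x z"
    and fixd: "\<And>l x. l \<in> L \<Longrightarrow> x \<in> Y \<Longrightarrow> (\<Sum>y\<in>Y. P x y * b l y) = b l x"
    and tr: "(\<Sum>x\<in>Y. P x x) \<le> real (card L)" using projection_onto_finite_span[OF Y L, of b] by blast
  have PM: "(\<Sum>y\<in>Y. P x y * M y z) = M x z" if x: "x \<in> Y" and z: "z \<in> Y" for x z
  proof -
    have "(\<Sum>y\<in>Y. P x y * M y z) = (\<Sum>y\<in>Y. \<Sum>l\<in>L. P x y * b l y * c l z)"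
      by (intro sum.cong refl) (simp add: M z sum_distrib_left mult.assoc)
    also have "\<dots> = (\<Sum>l\<in>L. (\<Sum>y\<in>Y. P x y * b l y) * c l z)"
      by (subst sum.swap) (simp add: sum_distrib_right)
    also have "\<dots> = M x z" using fixd x by (simp add: M x z)
    finally show ?thesis .
  qed
  have PP: "(\<Sum>(x, y)\<in>Y \<times> Y. (P x y)\<^sup>2) = (\<Sum>x\<in>Y. P x x)"
  proof -
    have "(\<Sum>(x, y)\<in>Y \<times> Y. (P x y)\<^sup>2) = (\<Sum>x\<in>Y. \<Sum>y\<in>Y. P x y * P y x)"
      unfolding sum.cartesian_product[symmetric]
      by (intro sum.cong refl) (metis power2_eq_square sym)
    then show ?thesis using idem by simp
  qed
  have "(\<Sum>x\<in>Y. M x x) = (\<Sum>x\<in>Y. \<Sum>y\<in>Y. P x y * M y x)" using PM by simp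
  also have "\<dots> = (\<Sum>(x, y)\<in>Y \<times> Y. P x y * M y x)" by (rule sum.cartesian_product)
  finally have "(\<Sum>x\<in>Y. M x x)\<^sup>2 = (\<Sum>p\<in>Y \<times> Y. (case p of (x, y) \<Rightarrow> P x y) * (case p of (x, y) \<Rightarrow> M y x))\<^sup>2"
    by (simp add: case_prod_beta)
  also have "\<dots> \<le> (\<Sum>p\<in>Y \<times> Y. (case p of (x, y) \<Rightarrow> P x y)\<^sup>2) * (\<Sum>p\<in>Y \<times> Y. (case p of (x, y) \<Rightarrow> M y x)\<^sup>2)"
    by (rule Cauchy_Schwarz_ineq_sum)
  also have "\<dots> = (\<Sum>x\<in>Y. P x x) * (\<Sum>x\<in>Y. \<Sum>y\<in>Y. (M y x)\<^sup>2)"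
    using PP by (simp add: case_prod_beta sum.cartesian_product)
  also have "(\<Sum>x\<in>Y. \<Sum>y\<in>Y. (M y x)\<^sup>2) = (\<Sum>x\<in>Y. \<Sum>y\<in>Y. (M x y)\<^sup>2)" by (rule sum.swap)
  also have "(\<Sum>x\<in>Y. P x x) * (\<Sum>x\<in>Y. \<Sum>y\<in>Y. (M x y)\<^sup>2) \<le> real (card L) * (\<Sum>x\<in>Y. \<Sum>y\<in>Y. (M x y)\<^sup>2)"
    by (intro mult_right_mono tr sum_nonneg) auto
  finally show ?thesis .
qed

subsection \<open>Homogeneous forms\<close>

text \<open>Multiplicities in the multiset serve as exponents, so monomials of degree
  \<open>m\<close> are counted as multisets of size \<open>m\<close>.\<close>

definition monomial_at :: "'d multiset \<Rightarrow> real ^ 'd \<Rightarrow> real" where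
  "monomial_at S x = (\<Prod>i\<in>#S. vec_nth x i)"

definition homogeneous_form :: "nat \<Rightarrow> (real ^ 'd::finite \<Rightarrow> real) \<Rightarrow> bool" where
  "homogeneous_form m f \<longleftrightarrow> (\<exists>c. \<forall>x. f x = (\<Sum>S\<in>multisets_of_size UNIV m. c S * monomial_at S x))"

lemma homogeneous_form_one: "homogeneous_form 0 (\<lambda>x. 1)"
  unfolding homogeneous_form_def by (auto simp: monomial_at_def)

lemma homogeneous_form_add:
  assumes "homogeneous_form m f" "homogeneous_form m g"
  shows "homogeneous_form m (\<lambda>x. f x + g x)"
proof -
  obtain c d where "\<And>x. f x = (\<Sum>S\<in>multisets_of_size UNIV m. c S * monomial_at S x)"
    "\<And>x. g x = (\<Sum>S\<in>multisets_of_size UNIV m. d S * monomial_at S x)"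
    using assms unfolding homogeneous_form_def by blast
  then show ?thesis unfolding homogeneous_form_def
    by (intro exI[of _ "\<lambda>S. c S + d S"]) (simp add: distrib_right sum.distrib)
qed

lemma homogeneous_form_scale:
  assumes "homogeneous_form m f"
  shows "homogeneous_form m (\<lambda>x. a * f x)"
proof -
  obtain c where "\<And>x. f x = (\<Sum>S\<in>multisets_of_size UNIV m. c S * monomial_at S x)"
    using assms unfolding homogeneous_form_def by blast
  then show ?thesis unfolding homogeneous_form_def
    by (intro exI[of _ "\<lambda>S. a * c S"]) (simp add: sum_distrib_left mult.assoc)
qed

lemma homogeneous_form_zero: "homogeneous_form m (\<lambda>x. 0)"
  unfolding homogeneous_form_def by (intro exI[of _ "\<lambda>_. 0"]) simp

lemma homogeneous_form_sum:
  assumes "\<And>i. i \<in> I \<Longrightarrow> homogeneous_form m (f i)"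
  shows "homogeneous_form m (\<lambda>x. \<Sum>i\<in>I. f i x)"
  using assms
  by (induction I rule: infinite_finite_induct)
     (auto intro: homogeneous_form_zero homogeneous_form_add)

lemma homogeneous_form_coordinate_mult:
  assumes "homogeneous_form m f"
  shows "homogeneous_form (Suc m) (\<lambda>x. vec_nth x j * f x)"
proof -
  obtain c where c: "\<And>x. f x = (\<Sum>S\<in>multisets_of_size UNIV m. c S * monomial_at S x)"
    using assms unfolding homogeneous_form_def by blast
  \<comment> \<open>Multiplication by the coordinate \<open>j\<close> sends the monomial
    \<open>S\<close> to \<open>add_mset j S\<close>. Reading this backwards gives the new
    coefficients, with 0 for monomials that do not contain \<open>j\<close>.\<close>
  let ?d = "\<lambda>T. if j \<in># T then c (T - {#j#}) else 0"
  have "vec_nth x j * f x = (\<Sum>T\<in>multisets_of_size UNIV (Suc m). ?d T * monomial_at T x)" for x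
  proof -
    have "vec_nth x j * f x = (\<Sum>S\<in>multisets_of_size UNIV m. ?d (add_mset j S) * monomial_at (add_mset j S) x)"
      by (simp add: c sum_distrib_left monomial_at_def mult_ac)
    also have "\<dots> = (\<Sum>T\<in>add_mset j ` multisets_of_size UNIV m. ?d T * monomial_at T x)"
      by (subst sum.reindex) (auto intro: inj_onI)
    also have "\<dots> = (\<Sum>T\<in>multisets_of_size UNIV (Suc m). ?d T * monomial_at T x)"
    proof (intro sum.mono_neutral_left ballI)
      show "finite (multisets_of_size (UNIV :: 'a set) (Suc m))" by (simp add: finite_multisets_of_size)
      show "add_mset j ` multisets_of_size UNIV m \<subseteq> multisets_of_size UNIV (Suc m)"
        by (auto simp: multisets_of_size_def)
      fix T assume T: "T \<in> multisets_of_size UNIV (Suc m) - add_mset j ` multisets_of_size UNIV m"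
      have "j \<notin># T"
      proof
        assume "j \<in># T"
        then obtain S where S: "T = add_mset j S" by (metis mset_add)
        then have "S \<in> multisets_of_size UNIV m" using T by (auto simp: multisets_of_size_def)
        then show False using S T by blast
      qed
      then show "?d T * monomial_at T x = 0" by simp
    qed
    finally show ?thesis .
  qed
  then show ?thesis unfolding homogeneous_form_def by (intro exI[of _ ?d] allI)
qed

lemma homogeneous_form_inner_mult:
  assumes "homogeneous_form m f"
  shows "homogeneous_form (Suc m) (\<lambda>x. inner x y * f x)"
proof -
  have "homogeneous_form (Suc m) (\<lambda>x. \<Sum>j\<in>UNIV. vec_nth y j * (vec_nth x j * f x))"
    by (intro homogeneous_form_sum homogeneous_form_scale homogeneous_form_coordinate_mult assms)
  then show ?thesis by (simp add: inner_vec_def sum_distrib_left sum_distrib_right mult_ac)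
qed

lemma homogeneous_form_norm_mult:
  assumes "homogeneous_form m f"
  shows "homogeneous_form (Suc (Suc m)) (\<lambda>x. inner x x * f x)"
proof -
  have "homogeneous_form (Suc (Suc m)) (\<lambda>x. \<Sum>j\<in>UNIV. vec_nth x j * (vec_nth x j * f x))"
    by (intro homogeneous_form_sum homogeneous_form_coordinate_mult assms)
  then show ?thesis by (simp add: inner_vec_def sum_distrib_left sum_distrib_right mult_ac)
qed

lemma homogeneous_form_norm_power: "homogeneous_form (2 * m) (\<lambda>x. inner x x ^ m)"
  by (induction m) (auto dest: homogeneous_form_norm_mult intro: homogeneous_form_one)

text \<open>Multiplying the constant \<open>p j\<close> by \<open>inner x x\<close> makes every
  factor a quadratic form in \<open>x\<close> for fixed \<open>y\<close>, so each index contributes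
  degree 2.\<close>

lemma homogeneous_form_prod_quadratic:
  assumes "finite J"
  shows "homogeneous_form (2 * card J) (\<lambda>x. \<Prod>j\<in>J. ((inner x y)\<^sup>2 - p j * inner x x) / q j)"
  using assms
proof (induction J rule: finite_induct)
  case empty
  show ?case by (simp add: homogeneous_form_one)
next
  case (insert j J)
  let ?f = "\<lambda>x. \<Prod>j\<in>J. ((inner x y)\<^sup>2 - p j * inner x x) / q j"
  have "homogeneous_form (Suc (Suc (2 * card J)))
      (\<lambda>x. (1 / q j) * (inner x y * (inner x y * ?f x)) + (- p j / q j) * (inner x x * ?f x))"
    by (intro homogeneous_form_add homogeneous_form_scale homogeneous_form_inner_mult
        homogeneous_form_norm_mult insert.IH)
  moreover have "(1 / q j) * (inner x y * (inner x y * ?f x)) + (- p j / q j) * (inner x x * ?f x)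
     = (\<Prod>j\<in>insert j J. ((inner x y)\<^sup>2 - p j * inner x x) / q j)" for x
    using insert.hyps by (simp add: power2_eq_square diff_divide_distrib left_diff_distrib)
  ultimately show ?case using insert.hyps by simp
qed

text \<open>The rank bound: each \<open>F y\<close> is a combination of the same monomials, so the
  kernel separates with one term for each monomial of degree \<open>m\<close> in
  \<open>CARD('d)\<close> variables.\<close>

lemma homogeneous_forms_factorization:
  fixes F :: "'i \<Rightarrow> real ^ 'd::finite \<Rightarrow> real"
  assumes "\<And>y. homogeneous_form m (F y)"
  obtains b c where "\<And>x y. F y x = (\<Sum>l<(CARD('d) + m - 1) choose m. b l x * c l y)"
proof -
  let ?I = "multisets_of_size (UNIV :: 'd set) m"
  let ?N = "(CARD('d) + m - 1) choose m"
  have "finite ?I" "card ?I = ?N" by (simp_all add: card_multisets_of_size finite_multisets_of_size)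
  then obtain e where e: "bij_betw e {..<?N} ?I"
    by (metis ex_bij_betw_nat_finite lessThan_atLeast0)
  obtain c where c: "\<And>x y. F y x = (\<Sum>S\<in>?I. c y S * monomial_at S x)"
    using assms unfolding homogeneous_form_def by metis
  have "F y x = (\<Sum>l<?N. monomial_at (e l) x * c y (e l))" for x y
    unfolding c using sum.reindex_bij_betw[OF e, of "\<lambda>S. c y S * monomial_at S x"]
    by (simp add: mult.commute)
  then show ?thesis using that[of "\<lambda>l. monomial_at (e l)" "\<lambda>l y. c y (e l)"] by blast
qed

subsection \<open>Integrality from low rank\<close>

text \<open>The hypothesis reads \<open>k I + A = B C\<close>, that is
  \<open>A = B C + (- k) I\<close> with inner dimension \<open>N\<close>. The double negation keeps
  the divisor in the shape \<open>[:- x, 1:]\<close> for the eigenvalue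
  \<open>x = - k\<close>.\<close>

lemma char_poly_of_factored_entries:
  fixes a :: "nat \<Rightarrow> nat \<Rightarrow> int"
  assumes "N \<le> n"
    and M: "\<And>i j. i < n \<Longrightarrow> j < n \<Longrightarrow> (if i = j then k else 0) + of_int (a i j) = (\<Sum>l<N. b l i * c l j)"
  shows "[:- (- k), 1:] ^ (n - N) dvd (map_poly of_int (char_poly (mat n n (\<lambda>(i, j). a i j))) :: real poly)"
proof -
  let ?B = "mat n N (\<lambda>(i, l). b l i)" and ?C = "mat N n (\<lambda>(l, j). c l j)"
  have "map_mat of_int (mat n n (\<lambda>(i, j). a i j)) = ?B * ?C + (- k) \<cdot>\<^sub>m 1\<^sub>m n"
  proof (rule eq_matI)
    fix i j assume ij: "i < dim_row (?B * ?C + (- k) \<cdot>\<^sub>m 1\<^sub>m n)" "j < dim_col (?B * ?C + (- k) \<cdot>\<^sub>m 1\<^sub>m n)"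
    then have "(?B * ?C) $$ (i, j) = (\<Sum>l<N. b l i * c l j)"
      by (simp add: scalar_prod_def lessThan_atLeast0)
    then show "map_mat of_int (mat n n (\<lambda>(i, j). a i j)) $$ (i, j) = (?B * ?C + (- k) \<cdot>\<^sub>m 1\<^sub>m n) $$ (i, j)"
      using ij M[of i j] by (auto split: if_splits)
  qed auto
  then have "char_poly (?B * ?C + (- k) \<cdot>\<^sub>m 1\<^sub>m n)
      = (map_poly of_int (char_poly (mat n n (\<lambda>(i, j). a i j))) :: real poly)"
    using of_int_hom.char_poly_hom[of "mat n n (\<lambda>(i, j). a i j)" n] by (metis mat_carrier)
  then show ?thesis
    using char_poly_low_rank_plus_scalar[of ?B n N ?C "- k"] assms(1) by simp
qed

lemma frobenius_constant_off_diagonal: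
  fixes M :: "nat \<Rightarrow> nat \<Rightarrow> real"
  assumes "\<And>i. i < n \<Longrightarrow> (M i i)\<^sup>2 = p" "\<And>i j. i < n \<Longrightarrow> j < n \<Longrightarrow> i \<noteq> j \<Longrightarrow> (M i j)\<^sup>2 \<le> q"
  shows "(\<Sum>i<n. \<Sum>j<n. (M i j)\<^sup>2) \<le> real n * (p + (real n - 1) * q)"
proof -
  have "(\<Sum>j<n. (M i j)\<^sup>2) \<le> p + (real n - 1) * q" if i: "i < n" for i
  proof -
    have "(\<Sum>j<n. (M i j)\<^sup>2) = (M i i)\<^sup>2 + (\<Sum>j\<in>{..<n} - {i}. (M i j)\<^sup>2)"
      using i by (simp add: sum.remove)
    also have "(\<Sum>j\<in>{..<n} - {i}. (M i j)\<^sup>2) \<le> real (card ({..<n} - {i})) * q"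
      by (rule sum_bounded_above) (use assms(2) i in auto)
    also have "real (card ({..<n} - {i})) = real n - 1" using i by (simp add: of_nat_diff)
    finally show ?thesis using assms(1)[OF i] by simp
  qed
  then have "(\<Sum>i<n. \<Sum>j<n. (M i j)\<^sup>2) \<le> (\<Sum>i<n. p + (real n - 1) * q)"
    by (intro sum_mono) auto
  then show ?thesis by simp
qed

text \<open>With \<open>n = 2 * N + 1\<close> rows the eigenvalue \<open>- k\<close> has
  multiplicity at least \<open>N + 1\<close>, more than \<open>n / 2\<close>, hence is an integer.
  The diagonal is \<open>k\<close> and off-diagonal squares are at most 1, so the trace inequality
  reads \<open>n * k^2 \<le> N * (k^2 + 2 * N)\<close> after cancelling \<open>n\<close>.\<close>

lemma signed_low_rank_integrality:
  fixes a :: "nat \<Rightarrow> nat \<Rightarrow> int"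
  assumes a: "\<And>i j. a i j \<in> {- 1, 0, 1}" and a0: "\<And>i. a i i = 0"
    and M: "\<And>i j. i < 2 * N + 1 \<Longrightarrow> j < 2 * N + 1 \<Longrightarrow>
      (if i = j then k else 0) + of_int (a i j) = (\<Sum>l<N. b l i * c l j)"
  shows "k \<in> \<int>" "k\<^sup>2 \<le> 2 * (real N)\<^sup>2 / (real N + 1)"
proof -
  let ?n = "2 * N + 1"
  have "- k \<in> \<int>"
    by (rule integer_eigenvalue_of_large_multiplicity[OF _ _ char_poly_of_factored_entries[OF _ M]])
      auto
  then show "k \<in> \<int>" by simp
  define f where "f i j = (if i = j then k else 0) + of_int (a i j)" for i j
  have tr: "(\<Sum>i<?n. f i i)\<^sup>2 \<le> real (card {..<N}) * (\<Sum>i<?n. \<Sum>j<?n. (f i j)\<^sup>2)"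
    by (rule trace_squared_le_rank_times_frobenius) (auto simp: f_def M)
  have tf: "(\<Sum>i<?n. f i i) = real ?n * k" by (simp add: f_def a0)
  have fr: "(\<Sum>i<?n. \<Sum>j<?n. (f i j)\<^sup>2) \<le> real ?n * (k\<^sup>2 + (real ?n - 1) * 1)"
  proof (rule frobenius_constant_off_diagonal)
    show "(f i j)\<^sup>2 \<le> 1" if "i \<noteq> j" for i j using a[of i j] that by (auto simp: f_def)
  qed (simp add: f_def a0)
  have "(real ?n * k)\<^sup>2 \<le> real N * (real ?n * (k\<^sup>2 + (real ?n - 1) * 1))"
    using order_trans[OF tr mult_left_mono[OF fr]] unfolding tf by simp
  then have "real ?n * (real ?n * k\<^sup>2) \<le> real ?n * (real N * (k\<^sup>2 + 2 * real N))"
    by (simp add: power2_eq_square mult_ac)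
  then have "real ?n * k\<^sup>2 \<le> real N * (k\<^sup>2 + 2 * real N)"
    by (subst (asm) mult_le_cancel_left_pos) auto
  then have "k\<^sup>2 * (real N + 1) \<le> 2 * (real N)\<^sup>2" by (simp add: algebra_simps power2_eq_square)
  then show "k\<^sup>2 \<le> 2 * (real N)\<^sup>2 / (real N + 1)" by (simp add: pos_le_divide_eq)
qed

text \<open>With only \<open>2 * N\<close> rows, \<open>- k\<close> could still be a quadratic irrational. Then the characteristic
  polynomial would be determined by \<open>k\<close> alone, although subtracting the all-ones matrix changes the
  trace; this is why the hypothesis allows an arbitrary constant shift \<open>t\<close>.\<close>

lemma adjacency_low_rank_integrality:
  fixes a :: "nat \<Rightarrow> nat \<Rightarrow> int"
  assumes N: "N > 0" and a: "\<And>i j. a i j \<in> {0, 1}" and a0: "\<And>i. a i i = 0"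
    and M: "\<And>t. \<exists>b c. \<forall>i<2 * N. \<forall>j<2 * N. 
      (if i = j then k else 0) + of_int (a i j) - t = (\<Sum>l<N. b l i * c l j)"
  shows "k \<in> \<int>" "(k - 1 / 2)\<^sup>2 \<le> (2 * real N - 1) / 4"
proof -
  let ?n = "2 * N"
  define A where "A t = mat ?n ?n (\<lambda>(i, j). a i j - t)" for t
  have A: "A t \<in> carrier_mat ?n ?n" for t by (simp add: A_def)
  \<comment> \<open>The guaranteed multiplicity is \<open>2 * N - N\<close>, exactly half the size,
    for every integer shift.\<close>
  have dv: "[:- (- k), 1:] ^ N dvd (map_poly of_int (char_poly (A t)) :: real poly)" for t
  proof -
    obtain b c where bc: "\<And>i j. i < ?n \<Longrightarrow> j < ?n \<Longrightarrow>
        (if i = j then k else 0) + of_int (a i j) - of_int t = (\<Sum>l<N. b l i * c l j)"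
      using M by meson
    have "[:- (- k), 1:] ^ (?n - N) dvd (map_poly of_int (char_poly (A t)) :: real poly)"
      unfolding A_def
    proof (rule char_poly_of_factored_entries)
      show "(if i = j then k else 0) + of_int (a i j - t) = (\<Sum>l<N. b l i * c l j)"
        if "i < ?n" "j < ?n" for i j using bc[OF that] by (simp add: algebra_simps)
    qed simp
    then show ?thesis by simp
  qed
  show "k \<in> \<int>"
  proof (rule ccontr)
    assume "k \<notin> \<int>"
    then have "- k \<notin> \<int>" by simp
    then have eq: "char_poly (A 0) = char_poly (A 1)"
      by (intro char_poly_eq_of_non_integer_half_multiplicity[OF A A N dv dv])
    \<comment> \<open>The coefficient below the leading one is minus the trace: 0 for
      \<open>A 0\<close> but \<open>2 * N\<close> for \<open>A 1\<close>, so the two characteristic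
      polynomials differ.\<close>
    obtain m where m: "?n = Suc m" using N by (cases ?n) auto
    have "(\<Sum>i<?n. A t $$ (i, i)) = - t * ?n" for t by (simp add: A_def a0)
    then have "coeff (char_poly (A t)) m = t * ?n" for t
      using coeff_char_poly_trace[of "A t" m] A[of t] unfolding m by simp
    from this[of 0] this[of 1] eq N show False by simp
  qed
  obtain b c where bc: "\<And>i j. i < ?n \<Longrightarrow> j < ?n \<Longrightarrow>
      (if i = j then k else 0) + of_int (a i j) - 1 / 2 = (\<Sum>l<N. b l i * c l j)"
    using M by meson
  define f where "f i j = (if i = j then k else 0) + of_int (a i j) - 1 / 2" for i j
  have tr: "(\<Sum>i<?n. f i i)\<^sup>2 \<le> real (card {..<N}) * (\<Sum>i<?n. \<Sum>j<?n. (f i j)\<^sup>2)"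
    by (rule trace_squared_le_rank_times_frobenius) (use bc in \<open>auto simp: f_def\<close>)
  have tf: "(\<Sum>i<?n. f i i) = real ?n * (k - 1 / 2)" by (simp add: f_def a0)
  have fr: "(\<Sum>i<?n. \<Sum>j<?n. (f i j)\<^sup>2) \<le> real ?n * ((k - 1 / 2)\<^sup>2 + (real ?n - 1) * (1 / 4))"
  proof (rule frobenius_constant_off_diagonal)
    show "(f i j)\<^sup>2 \<le> 1 / 4" if "i \<noteq> j" for i j
      using a[of i j] that by (auto simp: f_def power2_eq_square)
  qed (simp add: f_def a0)
  have "(real ?n * (k - 1 / 2))\<^sup>2 \<le> real N * (real ?n * ((k - 1 / 2)\<^sup>2 + (real ?n - 1) * (1 / 4)))"
    using order_trans[OF tr mult_left_mono[OF fr]] unfolding tf by simp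
  \<comment> \<open>Since \<open>?n = 2 * N\<close>, the common factor \<open>?n * N\<close> cancels
    and leaves a factor 2 on the left.\<close>
  then have "(real ?n * real N) * (2 * (k - 1 / 2)\<^sup>2)
      \<le> (real ?n * real N) * ((k - 1 / 2)\<^sup>2 + (real ?n - 1) * (1 / 4))"
    unfolding power_mult_distrib power2_eq_square[of "real ?n"] by (simp only: of_nat_mult of_nat_numeral mult_ac)
  then have "2 * (k - 1 / 2)\<^sup>2 \<le> (k - 1 / 2)\<^sup>2 + (real ?n - 1) * (1 / 4)"
    by (subst (asm) mult_le_cancel_left_pos) (use N in auto)
  then show "(k - 1 / 2)\<^sup>2 \<le> (2 * real N - 1) / 4" by simp
qed

subsection \<open>Antipodal spherical sets\<close>

text \<open>An inclusion-maximal subset without antipodal pairs works: by maximality every point of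
  \<open>X\<close> or its negative lies in \<open>Y\<close>, so \<open>X\<close> is covered by
  \<open>Y\<close> and its reflection.\<close>

lemma antipodal_half:
  fixes X :: "'a::real_vector set"
  assumes X: "finite X" "antipodal X"
  obtains Y where "Y \<subseteq> X" "card X \<le> 2 * card Y" "\<And>x y. x \<in> Y \<Longrightarrow> y \<in> Y \<Longrightarrow> x \<noteq> y \<Longrightarrow> x \<noteq> - y"
proof -
  define S where "S = {Y. Y \<subseteq> X \<and> (\<forall>x\<in>Y. \<forall>y\<in>Y. x \<noteq> y \<longrightarrow> x \<noteq> - y)}"
  have "finite S" using X(1) by (simp add: S_def)
  moreover have "{} \<in> S" by (simp add: S_def)
  ultimately obtain Y where "Y \<in> S" and max: "\<And>Z. Z \<in> S \<Longrightarrow> Y \<subseteq> Z \<Longrightarrow> Z = Y"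
    using finite_has_maximal2[of S "{}"] by metis
  then have Y: "Y \<subseteq> X" "\<And>x y. x \<in> Y \<Longrightarrow> y \<in> Y \<Longrightarrow> x \<noteq> y \<Longrightarrow> x \<noteq> - y" by (auto simp: S_def)
  have fin: "finite Y" using Y(1) X(1) by (rule finite_subset)
  have "X \<subseteq> Y \<union> uminus ` Y"
  proof
    fix x assume x: "x \<in> X"
    show "x \<in> Y \<union> uminus ` Y"
    proof (rule ccontr)
      assume nx: "x \<notin> Y \<union> uminus ` Y"
      have "- x \<notin> Y" using nx by (metis UnCI image_eqI minus_minus)
      then have "insert x Y \<in> S" unfolding S_def using x Y by auto
      then show False using max[of "insert x Y"] nx by auto
    qed
  qed
  then have "card X \<le> card (Y \<union> uminus ` Y)" using fin by (intro card_mono) auto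
  also have "\<dots> \<le> card Y + card (uminus ` Y)" by (rule card_Un_le)
  also have "\<dots> \<le> 2 * card Y" using card_image_le[OF fin, of uminus] by simp
  finally show ?thesis using that Y by blast
qed

lemma inner_eq_minus_one_iff:
  fixes x y :: "'a::real_inner"
  assumes "norm x = 1" "norm y = 1"
  shows "inner x y = - 1 \<longleftrightarrow> x = - y"
proof -
  have "(norm (x + y))\<^sup>2 = 2 + 2 * inner x y"
    using assms by (simp add: power2_norm_eq_inner inner_add_left inner_add_right inner_commute norm_eq_1)
  then have "inner x y = - 1 \<longleftrightarrow> norm (x + y) = 0" by (auto simp: power2_eq_square)
  then show ?thesis by (simp add: eq_neg_iff_add_eq_0)
qed

text \<open>The union has at most \<open>2 * t + 1\<close> elements, and reaching this number
  excludes any collapse. This makes the denominators in \<open>k_i\<close> nonzero.\<close>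

lemma symmetric_union_full_card:
  fixes \<beta> :: "nat \<Rightarrow> real"
  assumes card: "card ({- 1} \<union> (\<Union>j\<in>{1..t}. {\<beta> j, - \<beta> j})) = Suc (2 * t)"
  shows "\<And>i. i \<in> {1..t} \<Longrightarrow> \<beta> i \<noteq> 0"
    and "\<And>i j. i \<in> {1..t} \<Longrightarrow> j \<in> {1..t} \<Longrightarrow> i \<noteq> j \<Longrightarrow> (\<beta> i)\<^sup>2 \<noteq> (\<beta> j)\<^sup>2"
proof -
  have bound: "card ({- 1} \<union> (\<Union>j\<in>J. {\<beta> j, - \<beta> j})) \<le> Suc (2 * card J)" if "finite J" for J
  proof -
    have "card (\<Union>j\<in>J. {\<beta> j, - \<beta> j}) \<le> (\<Sum>j\<in>J. card {\<beta> j, - \<beta> j})"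
      using that by (rule card_UN_le)
    also have "\<dots> \<le> (\<Sum>j\<in>J. 2)"
      by (intro sum_mono) (simp add: card_insert_if)
    finally have "card (\<Union>j\<in>J. {\<beta> j, - \<beta> j}) \<le> 2 * card J" by simp
    then show ?thesis using card_Un_le[of "{- 1}" "\<Union>j\<in>J. {\<beta> j, - \<beta> j}"] by simp
  qed
  have red: False if i: "i \<in> {1..t}" and b: "{\<beta> i, - \<beta> i} \<subseteq> (\<Union>j\<in>{1..t} - {i}. {\<beta> j, - \<beta> j})" for i
  proof -
    have "(\<Union>j\<in>{1..t}. {\<beta> j, - \<beta> j}) = (\<Union>j\<in>{1..t} - {i}. {\<beta> j, - \<beta> j})"
      using i b by blast
    then have "Suc (2 * t) \<le> Suc (2 * card ({1..t} - {i}))"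
      using card bound[of "{1..t} - {i}"] by simp
    then show False using i by (cases t) auto
  qed
  show "(\<beta> i)\<^sup>2 \<noteq> (\<beta> j)\<^sup>2" if "i \<in> {1..t}" "j \<in> {1..t}" "i \<noteq> j" for i j
  proof
    assume "(\<beta> i)\<^sup>2 = (\<beta> j)\<^sup>2"
    then have "{\<beta> i, - \<beta> i} = {\<beta> j, - \<beta> j}" by (auto simp: power2_eq_iff)
    then show False using that red[of i] by blast
  qed
  show "\<beta> i \<noteq> 0" if i: "i \<in> {1..t}" for i
  proof
    assume 0: "\<beta> i = 0"
    have "(\<Union>j\<in>{1..t}. {\<beta> j, - \<beta> j}) = {0} \<union> (\<Union>j\<in>{1..t} - {i}. {\<beta> j, - \<beta> j})"
      using i 0 by auto
    then have "Suc (2 * t) = card (insert 0 ({- 1} \<union> (\<Union>j\<in>{1..t} - {i}. {\<beta> j, - \<beta> j})))"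
      using card by (simp add: insert_commute)
    also have "\<dots> \<le> Suc (card ({- 1} \<union> (\<Union>j\<in>{1..t} - {i}. {\<beta> j, - \<beta> j})))"
      by (simp add: card_insert_if)
    also have "\<dots> \<le> Suc (Suc (2 * card ({1..t} - {i})))" using bound[of "{1..t} - {i}"] by simp
    finally show False using i by (cases t) auto
  qed
qed

text \<open>The trace bound is at least as strong as the one built into \<open>U\<close>, and as
  \<open>k\<close> is an integer its absolute value may be compared with the floor.\<close>

lemma abs_le_U:
  assumes N: "N > 0" and k: "k \<in> \<int>" and b: "(k - 1 / 2)\<^sup>2 \<le> (2 * real N - 1) / 4"
  shows "\<bar>k\<bar> \<le> real_of_int (U N)"
proof -
  obtain z where z: "k = of_int z" using k by (elim Ints_cases)
  have "(2 * real N - 1) / 4 \<le> (real N)\<^sup>2 / (2 * real N - 2) + 1 / 4"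
  \<comment> \<open>For \<open>N = 1\<close> the quotient has denominator 0 and therefore value 0,
    and both sides equal \<open>1 / 4\<close>.\<close>
  proof (cases "N = 1")
    case False
    then have "real N > 1" using N by simp
    then show ?thesis by (simp add: field_simps power2_eq_square)
  qed simp
  then have "\<bar>k - 1 / 2\<bar> \<le> sqrt ((real N)\<^sup>2 / (2 * real N - 2) + 1 / 4)"
    by (intro real_le_rsqrt) (simp only: power2_abs, rule order_trans[OF b])
  then have "\<bar>k\<bar> \<le> 1 / 2 + sqrt ((real N)\<^sup>2 / (2 * real N - 2) + 1 / 4)" by linarith
  then have "\<bar>z\<bar> \<le> U N" unfolding U_def z by (simp add: le_floor_iff)
  then show ?thesis unfolding z by linarith
qed

lemma abs_le_floor_sqrt:
  assumes "k \<in> \<int>" "k\<^sup>2 \<le> r"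
  shows "\<bar>k\<bar> \<le> real_of_int \<lfloor>sqrt r\<rfloor>"
proof -
  obtain z where z: "k = of_int z" using assms(1) by (elim Ints_cases)
  have "\<bar>k\<bar> \<le> sqrt r" using assms(2) by (intro real_le_rsqrt) simp
  then have "\<bar>z\<bar> \<le> \<lfloor>sqrt r\<rfloor>" unfolding z by (simp add: le_floor_iff)
  then show ?thesis unfolding z by linarith
qed

text \<open>Points chosen from the antipode-free half never have inner product \<open>- 1\<close>,
  so only the values \<open>\<beta> l\<close> and \<open>- \<beta> l\<close> remain. Indexing
  exactly \<open>n\<close> of them by naturals fits the matrix lemmas.\<close>

lemma enumerate_half:
  fixes X :: "(real ^ 'd) set" and \<beta> :: "nat \<Rightarrow> real"
  assumes fin: "finite X" and sph: "on_unit_sphere X" and anti: "antipodal X"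
    and inn: "inner_set X = {- 1} \<union> (\<Union>j\<in>{1..t}. {\<beta> j, - \<beta> j})" and n: "card X \<ge> 2 * n"
  shows "\<exists>v :: nat \<Rightarrow> real ^ 'd. (\<forall>a<n. norm (v a) = 1) \<and>
    (\<forall>a<n. \<forall>b<n. a \<noteq> b \<longrightarrow> (\<exists>l\<in>{1..t}. inner (v a) (v b) \<in> {\<beta> l, - \<beta> l}))"
proof -
  obtain Y where Y: "Y \<subseteq> X" "card X \<le> 2 * card Y"
    "\<And>x y. x \<in> Y \<Longrightarrow> y \<in> Y \<Longrightarrow> x \<noteq> y \<Longrightarrow> x \<noteq> - y"
    using antipodal_half[OF fin anti] by metis
  have finY: "finite Y" using Y(1) fin finite_subset by blast
  have "n \<le> card Y" using Y(2) n by linarith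
  then obtain Z where Z: "Z \<subseteq> Y" "card Z = n" "finite Z" by (rule obtain_subset_with_card_n)
  obtain v where v: "bij_betw v {..<n} Z"
    using ex_bij_betw_nat_finite[OF Z(3)] Z(2) by (metis lessThan_atLeast0)
  have vZ: "v i \<in> Z" if "i < n" for i using v that by (auto simp: bij_betw_def)
  have nrm: "norm (v i) = 1" if "i < n" for i
    using vZ[OF that] Z(1) Y(1) sph unfolding on_unit_sphere_def by (meson mem_sphere_0 subsetD)
  have ex: "\<exists>l\<in>{1..t}. inner (v i) (v j) \<in> {\<beta> l, - \<beta> l}" if ij: "i < n" "j < n" "i \<noteq> j" for i j
  proof -
    have ne: "v i \<noteq> v j" using v ij by (auto simp: bij_betw_def inj_on_def)
    then have "v i \<noteq> - v j" using vZ ij Z(1) Y(3) by blast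
    then have "inner (v i) (v j) \<noteq> - 1" using inner_eq_minus_one_iff nrm ij by blast
    moreover have "inner (v i) (v j) \<in> inner_set X"
      unfolding inner_set_def using ne vZ ij Z(1) Y(1) by blast
    ultimately show ?thesis unfolding inn by blast
  qed
  show ?thesis using nrm ex by (intro exI[of _ v]) simp
qed

text \<open>This is the Lagrange basis polynomial for the nodes \<open>(\<beta> j)^2\<close>,
  evaluated at the node \<open>u^2\<close>.\<close>

lemma prod_delta_values:
  fixes \<beta> :: "nat \<Rightarrow> real"
  assumes "finite J" "l \<in> J" "i \<in> J" "u\<^sup>2 = (\<beta> l)\<^sup>2"
    and ne: "\<And>i j. i \<in> J \<Longrightarrow> j \<in> J \<Longrightarrow> i \<noteq> j \<Longrightarrow> (\<beta> i)\<^sup>2 \<noteq> (\<beta> j)\<^sup>2"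
  shows "(\<Prod>j\<in>J - {i}. (u\<^sup>2 - (\<beta> j)\<^sup>2) / ((\<beta> i)\<^sup>2 - (\<beta> j)\<^sup>2)) = (if u\<^sup>2 = (\<beta> i)\<^sup>2 then 1 else 0)"
proof (cases "l = i")
  case True
  then show ?thesis using assms by (auto intro!: prod.neutral)
next
  case False
  then show ?thesis using assms ne[of l i] by (auto intro!: prod_zero bexI[of _ l])
qed

theorem theorem5p2:
  fixes X :: "(real ^ 'd) set" and s :: nat and \<beta> :: "nat \<Rightarrow> real"
  assumes "s \<ge> 5" and "odd s"
    and "on_unit_sphere X" and "antipodal X" and "s_distance_set X s"
    and "inner_set X = {-1} \<union> (\<Union>j\<in>{1..(s-1) div 2}. {\<beta> j, - \<beta> j})"
    and "card (inner_set X) = s"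
  shows "(let N = (CARD('d) + s - 4) choose (s - 3) in
           card X \<ge> 4 * N \<longrightarrow>
           (\<forall>i\<in>{1..(s-1) div 2}.
              let k = (\<Prod>j\<in>{1..(s-1) div 2} - {i}. (1 - (\<beta> j)^2) / ((\<beta> i)^2 - (\<beta> j)^2))
              in k \<in> \<int> \<and> \<bar>k\<bar> \<le> real_of_int (U N)))
       \<and> (let N = (CARD('d) + s - 3) choose (s - 2) in
           card X \<ge> 4 * N + 2 \<longrightarrow>
           (\<forall>i\<in>{1..(s-1) div 2}.
              let k = (1 / \<beta> i) * (\<Prod>j\<in>{1..(s-1) div 2} - {i}. (1 - (\<beta> j)^2) / ((\<beta> i)^2 - (\<beta> j)^2))
              in k \<in> \<int> \<and> \<bar>k\<bar> \<le> real_of_int \<lfloor>sqrt (2 * (real N)^2 / (real N + 1))\<rfloor>))"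
proof -
  define t where "t = (s - 1) div 2"
  have s: "s = Suc (2 * t)" "t \<ge> 2" using assms(1,2) by (auto simp: t_def elim!: oddE)
  have fin: "finite X" using assms(5) by (simp add: s_distance_set_def)
  let ?J = "{1..t}"
  have inn: "inner_set X = {- 1} \<union> (\<Union>j\<in>?J. {\<beta> j, - \<beta> j})" using assms(6) by (simp add: t_def)
  have "card ({- 1} \<union> (\<Union>j\<in>?J. {\<beta> j, - \<beta> j})) = Suc (2 * t)" using assms(7) inn s(1) by metis
  note \<beta>0 = symmetric_union_full_card(1)[OF this] and \<beta>ne = symmetric_union_full_card(2)[OF this]
  \<comment> \<open>The annihilator polynomial in \<open>inner x y\<close>, homogenized by powers of \<open>inner x x\<close>, which is 1 on the sphere.\<close>
  define G where "G i y x = (\<Prod>j\<in>?J - {i}. ((inner x y)\<^sup>2 - (\<beta> j)\<^sup>2 * inner x x) / ((\<beta> i)\<^sup>2 - (\<beta> j)\<^sup>2))"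
    for i and x y :: "real ^ 'd"
  \<comment> \<open>The annihilator at inner product 1, hence the diagonal of the matrix. It is
    \<open>k_i\<close> in the first claim, and \<open>k_i\<close> is \<open>K i\<close> divided by
    \<open>\<beta> i\<close> in the second.\<close>
  define K where "K i = (\<Prod>j\<in>?J - {i}. (1 - (\<beta> j)\<^sup>2) / ((\<beta> i)\<^sup>2 - (\<beta> j)\<^sup>2))" for i
  have G: "homogeneous_form (s - 3) (G i y)" if "i \<in> ?J" for i y
  proof -
    have "2 * card (?J - {i}) = s - 3" using s that by simp
    then show ?thesis unfolding G_def[abs_def]
      using homogeneous_form_prod_quadratic[of "?J - {i}" y "\<lambda>j. (\<beta> j)\<^sup>2" "\<lambda>j. (\<beta> i)\<^sup>2 - (\<beta> j)\<^sup>2"] by simp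
  qed
  have Gself: "G i x x = K i" if "norm x = 1" for i x
    using that by (simp add: G_def K_def norm_eq_1)
  have Goff: "G i y x = (if (inner x y)\<^sup>2 = (\<beta> i)\<^sup>2 then 1 else 0)"
    if "i \<in> ?J" "norm x = 1" and l: "\<exists>l\<in>?J. inner x y \<in> {\<beta> l, - \<beta> l}" for i x y
  proof -
    obtain l where "l \<in> ?J" "(inner x y)\<^sup>2 = (\<beta> l)\<^sup>2" using l by auto
    then show ?thesis unfolding G_def
      using prod_delta_values[of ?J l i "inner x y" \<beta>] \<beta>ne that(1,2) by (simp add: norm_eq_1)
  qed

  \<comment> \<open>Even degree \<open>s - 3\<close>: adjacency matrices with a free constant
    shift\<close>
  have part1: "K i \<in> \<int> \<and> \<bar>K i\<bar> \<le> real_of_int (U N)"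
    if N: "N = (CARD('d) + s - 4) choose (s - 3)" and cX: "card X \<ge> 4 * N" and i: "i \<in> ?J" for N i
  proof -
    have N': "N = (CARD('d) + (s - 3) - 1) choose (s - 3)" using N s by simp
    have "CARD('d) > 0" by simp
    then have N0: "N > 0" unfolding N' by (intro zero_less_binomial) linarith
    have "card X \<ge> 2 * (2 * N)" using cX by simp
    then have "\<exists>v :: nat \<Rightarrow> real ^ 'd. (\<forall>a<2 * N. norm (v a) = 1) \<and>
      (\<forall>a<2 * N. \<forall>b<2 * N. a \<noteq> b \<longrightarrow> (\<exists>l\<in>?J. inner (v a) (v b) \<in> {\<beta> l, - \<beta> l}))"
      by (rule enumerate_half[OF fin assms(3,4) inn])
    then obtain v :: "nat \<Rightarrow> real ^ 'd" where v': "\<forall>a<2 * N. norm (v a) = 1"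
      "\<forall>a<2 * N. \<forall>b<2 * N. a \<noteq> b \<longrightarrow> (\<exists>l\<in>?J. inner (v a) (v b) \<in> {\<beta> l, - \<beta> l})"
      by (elim exE conjE)
    have v: "norm (v a) = 1" "b < 2 * N \<Longrightarrow> a \<noteq> b \<Longrightarrow> \<exists>l\<in>?J. inner (v a) (v b) \<in> {\<beta> l, - \<beta> l}"
      if "a < 2 * N" for a b
      using v' that by simp_all
    \<comment> \<open>The graph joining points whose inner product is \<open>\<beta> i\<close> or
      \<open>- \<beta> i\<close>; the annihilator cannot distinguish the two signs because it is
      even.\<close>
    define A where "A a b = (if a \<noteq> b \<and> (inner (v a) (v b))\<^sup>2 = (\<beta> i)\<^sup>2 then 1 else 0 :: int)" for a b
    have ex: "\<exists>b c. \<forall>a<2 * N. \<forall>a'<2 * N.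
      (if a = a' then K i else 0) + of_int (A a a') - r = (\<Sum>l<N. b l a * c l a')" for r
    proof -
      \<comment> \<open>Since \<open>s - 3 = 2 * (t - 1)\<close> is even, the constant
        \<open>r\<close> can be written on the sphere as \<open>r\<close> times a power of
        \<open>inner x x\<close> of the same degree. The shift therefore stays within the same
        \<open>N\<close> monomials.\<close>
      define F where "F y = (\<lambda>x. G i y x + (- r) * inner x x ^ (t - 1))" for y
      have "homogeneous_form (s - 3) (\<lambda>x. inner x x ^ (t - 1))"
        using homogeneous_form_norm_power[of "t - 1"] s by (simp add: diff_mult_distrib2)
      then have hom: "homogeneous_form (s - 3) (F y)" for y
        unfolding F_def by (intro homogeneous_form_add homogeneous_form_scale G i)
      obtain b c where bc: "\<And>x y. F y x = (\<Sum>l<N. b l x * c l y)"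
        using homogeneous_forms_factorization[of "s - 3" F, OF hom, folded N'] by metis
      have "(if a = a' then K i else 0) + of_int (A a a') - r = (\<Sum>l<N. b l (v a) * c l (v a'))"
        if a: "a < 2 * N" "a' < 2 * N" for a a'
      proof (cases "a = a'")
        case True
        then show ?thesis using v(1)[OF a(2)] Gself[of "v a'" i] by (simp add: bc[symmetric] F_def A_def norm_eq_1)
      next
        case False
        then show ?thesis using v(1)[OF a(1)] Goff[OF i v(1)[OF a(1)] v(2)[OF a False]]
          by (simp add: bc[symmetric] F_def A_def norm_eq_1)
      qed
      then have "\<forall>a<2 * N. \<forall>a'<2 * N. (if a = a' then K i else 0) + of_int (A a a') - r = (\<Sum>l<N. b l (v a) * c l (v a'))"
        by (intro allI impI)
      then show ?thesis by (intro exI)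
    qed
    have "K i \<in> \<int>" "(K i - 1 / 2)\<^sup>2 \<le> (2 * real N - 1) / 4"
      using adjacency_low_rank_integrality[OF N0 _ _ ex] by (simp_all add: A_def)
    then show ?thesis using abs_le_U[OF N0] by blast
  qed

  \<comment> \<open>Odd degree \<open>s - 2\<close>: signed matrices\<close>
  have part2: "1 / \<beta> i * K i \<in> \<int> \<and> \<bar>1 / \<beta> i * K i\<bar> \<le> real_of_int \<lfloor>sqrt (2 * (real N)\<^sup>2 / (real N + 1))\<rfloor>"
    if N: "N = (CARD('d) + s - 3) choose (s - 2)" and cX: "card X \<ge> 4 * N + 2" and i: "i \<in> ?J" for N i
  proof -
    have "CARD('d) + s - 3 = CARD('d) + (s - 2) - 1" using s by linarith
    then have N': "N = (CARD('d) + (s - 2) - 1) choose (s - 2)" using N by (simp only:)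
    let ?n = "2 * N + 1"
    have "card X \<ge> 2 * ?n" using cX by simp
    then have "\<exists>v :: nat \<Rightarrow> real ^ 'd. (\<forall>a<?n. norm (v a) = 1) \<and>
      (\<forall>a<?n. \<forall>b<?n. a \<noteq> b \<longrightarrow> (\<exists>l\<in>?J. inner (v a) (v b) \<in> {\<beta> l, - \<beta> l}))"
      by (rule enumerate_half[OF fin assms(3,4) inn])
    then obtain v :: "nat \<Rightarrow> real ^ 'd" where v': "\<forall>a<?n. norm (v a) = 1"
      "\<forall>a<?n. \<forall>b<?n. a \<noteq> b \<longrightarrow> (\<exists>l\<in>?J. inner (v a) (v b) \<in> {\<beta> l, - \<beta> l})"
      by (elim exE conjE)
    have v: "norm (v a) = 1" "b < ?n \<Longrightarrow> a \<noteq> b \<Longrightarrow> \<exists>l\<in>?J. inner (v a) (v b) \<in> {\<beta> l, - \<beta> l}"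
      if "a < ?n" for a b
      using v' that by simp_all
    define A where "A a b = (if a = b then 0 else if inner (v a) (v b) = \<beta> i then 1
      else if inner (v a) (v b) = - \<beta> i then - 1 else 0 :: int)" for a b
    \<comment> \<open>The extra factor \<open>inner x y / \<beta> i\<close> raises the degree to
      \<open>s - 2\<close>, replaces the value 1 at \<open>\<beta> i\<close> and
      \<open>- \<beta> i\<close> by the sign, and divides the diagonal value by
      \<open>\<beta> i\<close>.\<close>
    define F where "F y = (\<lambda>x. (1 / \<beta> i) * (inner x y * G i y x))" for y
    have "Suc (s - 3) = s - 2" using s by simp
    then have hom: "homogeneous_form (s - 2) (F y)" for y
      unfolding F_def
      using homogeneous_form_scale[OF homogeneous_form_inner_mult[OF G[OF i, of y], of y], of "1 / \<beta> i"] by simp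
    obtain b c where bc: "\<And>x y. F y x = (\<Sum>l<N. b l x * c l y)"
      using homogeneous_forms_factorization[of "s - 2" F, OF hom, folded N'] by metis
    have "(if a = a' then 1 / \<beta> i * K i else 0) + of_int (A a a') = (\<Sum>l<N. b l (v a) * c l (v a'))"
      if a: "a < ?n" "a' < ?n" for a a'
    proof (cases "a = a'")
      case True
      have "inner (v a') (v a') = 1" using v(1)[OF a(2)] by (simp add: norm_eq_1)
      then show ?thesis using v(1)[OF a(2)] True by (simp add: bc[symmetric] F_def A_def Gself)
    next
      case False
      then show ?thesis using Goff[OF i v(1)[OF a(1)] v(2)[OF a False]] \<beta>0[OF i]
        by (auto simp: bc[symmetric] F_def A_def power2_eq_iff)
    qed
    then have "1 / \<beta> i * K i \<in> \<int>" "(1 / \<beta> i * K i)\<^sup>2 \<le> 2 * (real N)\<^sup>2 / (real N + 1)"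
      using signed_low_rank_integrality[of A N "1 / \<beta> i * K i" "\<lambda>l a. b l (v a)" "\<lambda>l a. c l (v a)"]
      by (auto simp: A_def)
    then show ?thesis using abs_le_floor_sqrt by blast
  qed
  show ?thesis using part1 part2 unfolding Let_def t_def[symmetric] K_def by blast
qed

end
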